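(* Let $f,g:\mathbb{R}\to\mathbb{R}$ be differentiable with $L$-Lipschitz continuous derivatives $f'$ and $g'$. Consider the problem of minimizing $f(x)+g(z)$ over $x,z\in\mathbb{R}$ subject to $x=z$, and let $\{(x(k),z(k),y(k))\}$ be generated by the Alternating Direction Method of Multipliers (ADMM) with fixed penalty parameter $\rho>L$ and with $y(0)=g'(z(0))$. Then $$\lim_{k\to\infty}(x(k),z(k),y(k))=(z^\star,z^\star,g'(z^\star)),$$ where $z^\star$ is determined as follows: (a) if $f'(z(0))+g'(z(0))=0$, then $z^\star=z(0)$; (b) if $f'(z(0))+g'(z(0))<0$, then $z^\star=\inf\{z\ge z(0)\mid f'(z)+g'(z)=0\}$; (c) if $f'(z(0))+g'(z(0))>0$, then $z^\star=\sup\{z\le z(0)\mid f'(z)+g'(z)=0\}$. Here $\inf\emptyset=+\infty$ and $\sup\emptyset=-\infty$; when $z^\star=\pm\infty$ the conclusion means that $x(k)$ and $z(k)$ diverge to $z^\star$.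
   Context: ADMM for this problem: with $L_\rho(x,z,y)=f(x)+g(z)+y(x-z)+\tfrac{\rho}{2}(x-z)^2$ and initial values $z(0),y(0)\in\mathbb{R}$, for $k=0,1,2,\dots$: $x(k+1)=\operatorname{argmin}_{x\in\mathbb{R}}L_\rho(x,z(k),y(k))$, then $z(k+1)=\operatorname{argmin}_{z\in\mathbb{R}}L_\rho(x(k+1),z,y(k))$, then $y(k+1)=y(k)+\rho\,(x(k+1)-z(k+1))$. (The penalty parameter $\rho$ should not be confused with the Lipschitz constant $L$.) *)

theory Defs
  imports "HOL-Analysis.Analysis"
begin

definition aug_lagrangian ::
    "(real \<Rightarrow> real) \<Rightarrow> (real \<Rightarrow> real) \<Rightarrow> real \<Rightarrow> real \<Rightarrow> real \<Rightarrow> real \<Rightarrow> real"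
  where "aug_lagrangian f g \<rho> x z y = f x + g z + y * (x - z) + \<rho> / 2 * (x - z)\<^sup>2"

(* "x = argmin" is read as "x is a global minimizer over the reals"; the initial data are
   z 0 and y 0, and x 0 is arbitrary because no update uses it. *)
definition admm_iterates ::
    "(real \<Rightarrow> real) \<Rightarrow> (real \<Rightarrow> real) \<Rightarrow> real \<Rightarrow>
     (nat \<Rightarrow> real) \<Rightarrow> (nat \<Rightarrow> real) \<Rightarrow> (nat \<Rightarrow> real) \<Rightarrow> bool"
  where "admm_iterates f g \<rho> x z y \<longleftrightarrow>
    (\<forall>k. is_arg_min (\<lambda>u. aug_lagrangian f g \<rho> u (z k) (y k)) (\<lambda>_. True) (x (Suc k)) \<and>
         is_arg_min (\<lambda>v. aug_lagrangian f g \<rho> (x (Suc k)) v (y k)) (\<lambda>_. True) (z (Suc k)) \<and>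
         y (Suc k) = y k + \<rho> * (x (Suc k) - z (Suc k)))"

(* Extended-real valued, so that Inf {} = \<infinity> and Sup {} = -\<infinity>. The parameters f' and g' are the
   derivatives of the two objectives and z0 is the initial value of z. *)
definition admm_limit :: "(real \<Rightarrow> real) \<Rightarrow> (real \<Rightarrow> real) \<Rightarrow> real \<Rightarrow> ereal"
  where "admm_limit f' g' z0 =
    (if f' z0 + g' z0 = 0 then ereal z0
     else if f' z0 + g' z0 < 0 then Inf (ereal ` {z. z \<ge> z0 \<and> f' z + g' z = 0})
     else Sup (ereal ` {z. z \<le> z0 \<and> f' z + g' z = 0}))"

end

theory Submission
  imports Defs
begin

text \<open>
  The \<open>z\<close>-update preserves \<open>y(k) = g'(z(k))\<close>, so ADMM reduces to a recursion for \<open>(x, z)\<close> alone.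
  Since \<open>\<rho> > L\<close>, the maps \<open>\<rho> t \<plusminus> f'(t)\<close> and \<open>\<rho> t \<plusminus> g'(t)\<close> are strictly increasing. If
  \<open>f' + g' < 0\<close> at \<open>z(k)\<close>, it follows that \<open>z(k) < x(k+1)\<close> and \<open>z(k) < z(k+1)\<close>, that
  \<open>f' + g' < 0\<close> at \<open>z(k+1)\<close>, and that no zero of \<open>f' + g'\<close> is jumped over. Hence \<open>z\<close> increases,
  and it either diverges or converges to a zero of \<open>f' + g'\<close>, necessarily the first one above
  \<open>z(0)\<close>. The case \<open>f' + g' > 0\<close> is the mirror image under \<open>t \<mapsto> -t\<close>.
\<close>

lemma lipschitz_strict_mono:
  fixes \<phi> :: "real \<Rightarrow> real"
  assumes "L-lipschitz_on UNIV \<phi>" "L < \<rho>"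
  shows "strict_mono (\<lambda>t. \<rho> * t + \<phi> t)" "strict_mono (\<lambda>t. \<rho> * t - \<phi> t)"
proof -
  have "\<bar>\<phi> t - \<phi> s\<bar> < \<rho> * t - \<rho> * s" if "s < t" for s t
  proof -
    have "\<bar>\<phi> t - \<phi> s\<bar> \<le> L * (t - s)"
      using lipschitz_onD[OF assms(1), of t s] that by (simp add: dist_real_def)
    also have "\<dots> < \<rho> * (t - s)"
      using assms(2) that by simp
    finally show ?thesis by (simp add: algebra_simps)
  qed
  then show "strict_mono (\<lambda>t. \<rho> * t + \<phi> t)" "strict_mono (\<lambda>t. \<rho> * t - \<phi> t)"
    by (fastforce intro!: strict_monoI)+
qed

text \<open>\<open>x_step\<close> and \<open>z_step\<close> are the first-order conditions of the
  two updates with \<open>g' (z k)\<close> substituted for \<open>y k\<close>. The locale speaks of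
  \<open>f'\<close> and \<open>g'\<close> only, so it can be instantiated again with reflected
  data.\<close>

locale admm_recursion =
  fixes f' g' :: "real \<Rightarrow> real" and L \<rho> :: real and x z :: "nat \<Rightarrow> real"
  assumes lip_f: "L-lipschitz_on UNIV f'"
    and lip_g: "L-lipschitz_on UNIV g'"
    and rho: "L < \<rho>"
    and x_step: "\<rho> * x (Suc k) + f' (x (Suc k)) = \<rho> * z k - g' (z k)"
    and z_step: "\<rho> * z (Suc k) + g' (z (Suc k)) = \<rho> * x (Suc k) + g' (z k)"
begin

lemma rho_pos: "0 < \<rho>"
  using lipschitz_on_nonneg[OF lip_f] rho by linarith

lemmas mono_f = lipschitz_strict_mono[OF lip_f rho, THEN strict_mono_less]
lemmas mono_g = lipschitz_strict_mono[OF lip_g rho, THEN strict_mono_less]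

lemma isCont_f: "isCont f' t" and isCont_g: "isCont g' t"
  using lipschitz_on_continuous_on[OF lip_f] lipschitz_on_continuous_on[OF lip_g]
  by (simp_all add: continuous_on_eq_continuous_at)

section \<open>One iteration from a point where \<open>f' + g'\<close> is negative\<close>

lemma less_x_step: "z k < x (Suc k)" if "f' (z k) + g' (z k) < 0"
  using mono_f(1)[of "z k" "x (Suc k)"] x_step[of k] that by linarith

lemma less_z_step: "z k < z (Suc k)" if "f' (z k) + g' (z k) < 0"
proof -
  have "\<rho> * z k < \<rho> * x (Suc k)"
    using less_x_step[OF that] rho_pos by simp
  then show ?thesis
    using mono_g(1)[of "z k" "z (Suc k)"] z_step[of k] by linarith
qed

text \<open>Adding the two steps turns the claim into a bound on the growth of \<open>f'\<close>
  from \<open>x (Suc k)\<close> to \<open>z (Suc k)\<close>: it must stay below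
  \<open>\<rho> * (z (Suc k) - z k)\<close>.\<close>

lemma sum_neg_step: "f' (z (Suc k)) + g' (z (Suc k)) < 0" if "f' (z k) + g' (z k) < 0"
proof -
  define a b c where "a = z k" and "b = x (Suc k)" and "c = z (Suc k)"
  have ab: "a < b" and ac: "a < c"
    using less_x_step[OF that] less_z_step[OF that] by (simp_all add: a_def b_def c_def)
  have sum_eq: "f' c + g' c = \<rho> * a - \<rho> * c + f' c - f' b"
    using x_step[of k] z_step[of k] by (simp add: a_def b_def c_def)
  have "f' c - f' b < \<rho> * c - \<rho> * a"
  proof (cases "b < c")
    case True
    have "\<rho> * a < \<rho> * b"
      using ab rho_pos by simp
    then show ?thesis
      using mono_f(2)[of b c] True by linarith
  next
    case False
    \<comment> \<open>When \<open>z\<close> does not pass \<open>x\<close>, the gap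
      \<open>b - c\<close> is controlled by the growth of \<open>g'\<close> from \<open>a\<close> to
      \<open>c\<close>, which is less than \<open>\<rho> * (c - a)\<close>.\<close>
    have "\<rho> * b - \<rho> * c = g' c - g' a"
      using z_step[of k] by (simp add: a_def b_def c_def)
    moreover have "g' c - g' a < \<rho> * c - \<rho> * a"
      using mono_g(2)[of a c] ac by linarith
    moreover have "f' c - f' b \<le> \<rho> * b - \<rho> * c"
      using mono_f(1)[of c b] False by (cases "b = c") auto
    ultimately show ?thesis by linarith
  qed
  then show ?thesis
    using sum_eq by (simp add: a_def b_def c_def)
qed

text \<open>A zero \<open>w\<close> of \<open>f' + g'\<close> is a fixed point of both updates, so
  comparison through the increasing maps carries \<open>z k < w\<close> over to
  \<open>x (Suc k)\<close> and then to \<open>z (Suc k)\<close>.\<close>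

lemma z_step_less_zero:
  assumes "f' (z k) + g' (z k) < 0" "f' w + g' w = 0" "z k < w"
  shows "z (Suc k) < w"
proof -
  have x_less: "x (Suc k) < w"
    using mono_f(1)[of "x (Suc k)" w] mono_g(2)[of "z k" w] x_step[of k] assms by linarith
  have "\<rho> * z k < \<rho> * x (Suc k)"
    using less_x_step[OF assms(1)] rho_pos by simp
  moreover have "\<rho> * x (Suc k) - f' (x (Suc k)) < \<rho> * w - f' w"
    using mono_f(2) x_less by blast
  \<comment> \<open>The two steps combine to \<open>\<rho> * z (Suc k) + g' (z (Suc k)) = \<rho> * z
    k - f' (x (Suc k))\<close>. The chain of inequalities bounds this by
    \<open>\<rho> * w - f' w\<close>, which equals \<open>\<rho> * w + g' w\<close>.\<close>
  ultimately show ?thesis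
    using mono_g(1)[of "z (Suc k)" w] x_step[of k] z_step[of k] assms(2) by linarith
qed

section \<open>Limits of the recursion for each sign of the starting value\<close>

lemma limit_is_zero:
  assumes "z \<longlonglongrightarrow> w"
  shows "x \<longlonglongrightarrow> w" "f' w + g' w = 0"
proof -
  have g_lim: "(\<lambda>k. g' (z k)) \<longlonglongrightarrow> g' w"
    by (rule isCont_tendsto_compose[OF isCont_g assms])
  \<comment> \<open>This is \<open>z_step\<close> solved for \<open>x (Suc k)\<close>; the
    difference of \<open>g'\<close> values vanishes in the limit.\<close>
  have "(\<lambda>k. z (Suc k) + (g' (z (Suc k)) - g' (z k)) / \<rho>) \<longlonglongrightarrow> w + (g' w - g' w) / \<rho>"
    using LIMSEQ_Suc[OF assms] LIMSEQ_Suc[OF g_lim] g_lim rho_pos by (intro tendsto_intros) auto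
  also have "(\<lambda>k. z (Suc k) + (g' (z (Suc k)) - g' (z k)) / \<rho>) = (\<lambda>k. x (Suc k))"
  proof
    fix k
    show "z (Suc k) + (g' (z (Suc k)) - g' (z k)) / \<rho> = x (Suc k)"
      using z_step[of k] rho_pos by (simp add: field_simps)
  qed
  finally have x_Suc: "(\<lambda>k. x (Suc k)) \<longlonglongrightarrow> w"
    by simp
  then show "x \<longlonglongrightarrow> w"
    by (rule LIMSEQ_imp_Suc)
  \<comment> \<open>Both sides of \<open>x_step\<close> converge, and equating their limits gives
    the zero.\<close>
  have "(\<lambda>k. \<rho> * x (Suc k) + f' (x (Suc k))) \<longlonglongrightarrow> \<rho> * w + f' w"
    by (intro tendsto_intros x_Suc isCont_tendsto_compose[OF isCont_f x_Suc])
  moreover have "(\<lambda>k. \<rho> * x (Suc k) + f' (x (Suc k))) \<longlonglongrightarrow> \<rho> * w - g' w"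
    unfolding x_step by (intro tendsto_intros assms g_lim)
  ultimately have "\<rho> * w + f' w = \<rho> * w - g' w"
    by (rule LIMSEQ_unique)
  then show "f' w + g' w = 0"
    by simp
qed

lemma stationary: "z k = z 0" if "f' (z 0) + g' (z 0) = 0"
proof (induction k)
  case (Suc k)
  have "x (Suc k) = z k"
    using lipschitz_strict_mono(1)[OF lip_f rho, THEN strict_mono_eq, of "x (Suc k)" "z k"]
      x_step[of k] that Suc by auto
  then show ?case
    using lipschitz_strict_mono(1)[OF lip_g rho, THEN strict_mono_eq, of "z (Suc k)" "z k"]
      z_step[of k] Suc by auto
qed simp

text \<open>The sequence \<open>z\<close> increases and stays below every element of
  \<open>S\<close>. If it is bounded, its limit belongs to \<open>S\<close> and is a lower bound of
  \<open>S\<close>, hence the infimum. If it is unbounded, \<open>S\<close> must be empty. The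
  convergent alternative omits \<open>x\<close>, whose limit comes from
  \<open>limit_is_zero\<close>.\<close>

lemma negative_start:
  assumes neg: "f' (z 0) + g' (z 0) < 0"
  defines "S \<equiv> {t. t \<ge> z 0 \<and> f' t + g' t = 0}"
  shows "(\<exists>w. Inf (ereal ` S) = ereal w \<and> z \<longlonglongrightarrow> w) \<or>
         Inf (ereal ` S) = \<infinity> \<and> filterlim x at_top sequentially \<and> filterlim z at_top sequentially"
proof -
  have neg_k: "f' (z k) + g' (z k) < 0" for k
    by (induction k) (use neg sum_neg_step in auto)
  have inc: "incseq z"
    by (rule incseq_SucI) (use less_z_step[OF neg_k] less_imp_le in blast)
  have below: "z k < w" if "w \<in> S" for w k
  proof (induction k)
    case 0
    then show ?case
      using that neg by (auto simp: S_def order_less_le)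
  next
    case (Suc k)
    then show ?case
      using that z_step_less_zero[OF neg_k] by (auto simp: S_def)
  qed
  show ?thesis
  proof (cases "bdd_above (range z)")
    case True
    then obtain w where w: "z \<longlonglongrightarrow> w"
      using LIMSEQ_incseq_SUP[OF True inc] by blast
    have "w \<in> S"
      using limit_is_zero(2)[OF w] incseq_le[OF inc w] by (simp add: S_def)
    moreover have "w \<le> v" if "v \<in> S" for v
      using LIMSEQ_le_const2[OF w] below[OF that] less_imp_le by blast
    ultimately have "Inf (ereal ` S) = ereal w"
      by (intro Inf_eqI) auto
    then show ?thesis
      using w by blast
  next
    case False
    then have "S = {}"
      using below by (auto simp: bdd_above_def intro: less_imp_le)
    have z_top: "filterlim z at_top sequentially"
      unfolding filterlim_at_top eventually_sequentially
    proof
      fix M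
      obtain N where "M < z N"
        using False by (auto simp: bdd_above_def not_le)
      then show "\<exists>N. \<forall>n\<ge>N. M \<le> z n"
        using incseqD[OF inc] by (meson less_imp_le order_trans)
    qed
    \<comment> \<open>The bound \<open>z k < x (Suc k)\<close> compares \<open>z\<close> with the
      shifted sequence, so divergence is shown for the shift first.\<close>
    have "filterlim (\<lambda>k. x (Suc k)) at_top sequentially"
      by (rule filterlim_at_top_mono[OF z_top]) (use less_x_step[OF neg_k] in \<open>simp add: less_imp_le\<close>)
    then have "filterlim x at_top sequentially"
      by (simp add: filterlim_sequentially_Suc)
    then show ?thesis
      using z_top \<open>S = {}\<close> by (simp add: top_ereal_def)
  qed
qed

text \<open>Under \<open>t \<mapsto> -t\<close> a derivative \<open>\<phi> t\<close> becomes
  \<open>- \<phi> (- t)\<close>. Both step equations merely change sign, while a positive starting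
  value of \<open>f' + g'\<close> becomes negative.\<close>

lemma mirrored: "admm_recursion (\<lambda>t. - f' (- t)) (\<lambda>t. - g' (- t)) L \<rho> (\<lambda>k. - x k) (\<lambda>k. - z k)"
proof
  have mirror: "L-lipschitz_on UNIV (\<lambda>t. - \<phi> (- t))" if "L-lipschitz_on UNIV \<phi>" for \<phi> :: "real \<Rightarrow> real"
    using lipschitz_on_nonneg[OF that]
    by (intro lipschitz_onI)
      (use lipschitz_onD[OF that, of "- s" "- t" for s t] in \<open>simp_all add: dist_minus\<close>)
  show "L-lipschitz_on UNIV (\<lambda>t. - f' (- t))" "L-lipschitz_on UNIV (\<lambda>t. - g' (- t))"
    using mirror lip_f lip_g by blast+
qed (use rho x_step z_step in \<open>simp_all add: algebra_simps\<close>)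

lemma positive_start:
  assumes pos: "f' (z 0) + g' (z 0) > 0"
  defines "S \<equiv> {t. t \<le> z 0 \<and> f' t + g' t = 0}"
  shows "(\<exists>w. Sup (ereal ` S) = ereal w \<and> z \<longlonglongrightarrow> w) \<or>
         Sup (ereal ` S) = -\<infinity> \<and> filterlim x at_bot sequentially \<and> filterlim z at_bot sequentially"
proof -
  interpret m: admm_recursion "\<lambda>t. - f' (- t)" "\<lambda>t. - g' (- t)" L \<rho> "\<lambda>k. - x k" "\<lambda>k. - z k"
    by (rule mirrored)
  \<comment> \<open>\<open>T\<close> is the set whose infimum \<open>negative_start\<close> yields
    for the mirrored recursion; it is the reflection of \<open>S\<close>.\<close>
  define T where "T = {t. t \<ge> - z 0 \<and> - f' (- t) + - g' (- t) = 0}"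
  have "T = uminus ` S"
  proof (intro set_eqI iffI)
    fix t assume "t \<in> T"
    then show "t \<in> uminus ` S"
      by (intro image_eqI[of _ _ "- t"]) (auto simp: T_def S_def)
  qed (auto simp: T_def S_def)
  then have "ereal ` T = uminus ` ereal ` S"
    by (simp add: image_image)
  then have inf_sup: "Inf (ereal ` T) = - Sup (ereal ` S)"
    by (simp add: ereal_Inf_uminus_image_eq)
  have start: "- f' (- (- z 0)) + - g' (- (- z 0)) < 0"
    using pos by simp
  have "(\<exists>w. Inf (ereal ` T) = ereal w \<and> (\<lambda>k. - z k) \<longlonglongrightarrow> w) \<or>
         Inf (ereal ` T) = \<infinity> \<and> filterlim (\<lambda>k. - x k) at_top sequentially
           \<and> filterlim (\<lambda>k. - z k) at_top sequentially"
    using m.negative_start[OF start] unfolding T_def by simp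
  then show ?thesis
  proof (elim disjE exE conjE)
    fix w assume "Inf (ereal ` T) = ereal w" and lim: "(\<lambda>k. - z k) \<longlonglongrightarrow> w"
    then have "Sup (ereal ` S) = ereal (- w)"
      using inf_sup by (metis ereal_uminus_uminus uminus_ereal.simps(1))
    moreover have "z \<longlonglongrightarrow> - w"
      using tendsto_minus[OF lim] by simp
    ultimately show ?thesis by blast
  next
    assume "Inf (ereal ` T) = \<infinity>" "filterlim (\<lambda>k. - x k) at_top sequentially"
      "filterlim (\<lambda>k. - z k) at_top sequentially"
    then show ?thesis
      using inf_sup by (simp add: filterlim_uminus_at_bot ereal_uminus_eq_reorder)
  qed
qed

text \<open>The alternatives assign different kinds of value to \<open>admm_limit\<close>, so
  knowing that value selects the matching behaviour.\<close>

lemma outcome: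
  "(\<exists>w. admm_limit f' g' (z 0) = ereal w \<and> z \<longlonglongrightarrow> w) \<or>
    admm_limit f' g' (z 0) = \<infinity> \<and> filterlim x at_top sequentially \<and> filterlim z at_top sequentially \<or>
    admm_limit f' g' (z 0) = -\<infinity> \<and> filterlim x at_bot sequentially \<and> filterlim z at_bot sequentially"
proof (cases "f' (z 0) + g' (z 0)" "0 :: real" rule: linorder_cases)
  case less
  then show ?thesis
    using negative_start[OF less] by (auto simp: admm_limit_def)
next
  case equal
  have "z \<longlonglongrightarrow> z 0"
    by (subst stationary[OF equal, abs_def]) (rule tendsto_const)
  then show ?thesis
    using equal by (simp add: admm_limit_def)
next
  case greater
  then show ?thesis
    using positive_start[OF greater] by (auto simp: admm_limit_def)
qed

end

section \<open>From the ADMM updates to the recursion\<close>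

lemma is_arg_min_imp_deriv_zero:
  fixes h :: "real \<Rightarrow> real"
  assumes "is_arg_min h (\<lambda>_. True) u" "(h has_real_derivative D) (at u)"
  shows "D = 0"
  using DERIV_local_min[OF assms(2), of 1] assms(1) by (auto simp: is_arg_min_def not_less)

text \<open>Fermat's rule for the two minimizations. The second and third equations share their
  right-hand side, so the dual update gives \<open>y (Suc k) = g' (z (Suc k))\<close>.\<close>

lemma admm_iterates_optimality:
  assumes df: "\<And>t. (f has_real_derivative f' t) (at t)"
    and dg: "\<And>t. (g has_real_derivative g' t) (at t)"
    and it: "admm_iterates f g \<rho> x z y"
  shows "f' (x (Suc k)) + y k + \<rho> * (x (Suc k) - z k) = 0"
    and "g' (z (Suc k)) = y k + \<rho> * (x (Suc k) - z (Suc k))"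
    and "y (Suc k) = y k + \<rho> * (x (Suc k) - z (Suc k))"
proof -
  have "((\<lambda>u. aug_lagrangian f g \<rho> u (z k) (y k)) has_real_derivative
      f' (x (Suc k)) + y k + \<rho> * (x (Suc k) - z k)) (at (x (Suc k)))"
    unfolding aug_lagrangian_def
    by (auto intro!: derivative_eq_intros df simp: field_simps)
  then show "f' (x (Suc k)) + y k + \<rho> * (x (Suc k) - z k) = 0"
    using is_arg_min_imp_deriv_zero it by (metis admm_iterates_def)
  have "((\<lambda>v. aug_lagrangian f g \<rho> (x (Suc k)) v (y k)) has_real_derivative
      g' (z (Suc k)) - y k - \<rho> * (x (Suc k) - z (Suc k))) (at (z (Suc k)))"
    unfolding aug_lagrangian_def
    by (auto intro!: derivative_eq_intros dg simp: field_simps)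
  then have "g' (z (Suc k)) - y k - \<rho> * (x (Suc k) - z (Suc k)) = 0"
    using is_arg_min_imp_deriv_zero it by (metis admm_iterates_def)
  then show "g' (z (Suc k)) = y k + \<rho> * (x (Suc k) - z (Suc k))"
    by simp
  show "y (Suc k) = y k + \<rho> * (x (Suc k) - z (Suc k))"
    using it by (simp add: admm_iterates_def)
qed

theorem corollary2:
  fixes f g f' g' :: "real \<Rightarrow> real"
    and L \<rho> :: real
    and x z y :: "nat \<Rightarrow> real"
  assumes "\<And>t. (f has_real_derivative f' t) (at t)"
    and "\<And>t. (g has_real_derivative g' t) (at t)"
    and "L-lipschitz_on UNIV f'"
    and "L-lipschitz_on UNIV g'"
    and "\<rho> > L"
    and "admm_iterates f g \<rho> x z y"
    and "y 0 = g' (z 0)"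
  shows "(\<forall>r. admm_limit f' g' (z 0) = ereal r \<longrightarrow>
             (\<lambda>k. (x k, z k, y k)) \<longlonglongrightarrow> (r, r, g' r)) \<and>
         (admm_limit f' g' (z 0) = \<infinity> \<longrightarrow>
             filterlim x at_top sequentially \<and> filterlim z at_top sequentially) \<and>
         (admm_limit f' g' (z 0) = -\<infinity> \<longrightarrow>
             filterlim x at_bot sequentially \<and> filterlim z at_bot sequentially)"
proof -
  note opt = admm_iterates_optimality[OF assms(1,2,6)]
  have y_eq: "y k = g' (z k)" for k
    using opt(2,3) assms(7) by (cases k) simp_all
  interpret admm_recursion f' g' L \<rho> x z
  proof
    fix k
    show "\<rho> * x (Suc k) + f' (x (Suc k)) = \<rho> * z k - g' (z k)"
      using opt(1)[of k] by (simp add: y_eq algebra_simps)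
    show "\<rho> * z (Suc k) + g' (z (Suc k)) = \<rho> * x (Suc k) + g' (z k)"
      using opt(2)[of k] by (simp add: y_eq algebra_simps)
  qed (use assms in auto)
  \<comment> \<open>With \<open>y\<close> eliminated, convergence of \<open>z\<close> forces that of
    \<open>x\<close>, and continuity of \<open>g'\<close> gives the limit of
    \<open>y\<close>.\<close>
  have "(\<lambda>k. (x k, z k, y k)) \<longlonglongrightarrow> (r, r, g' r)" if "z \<longlonglongrightarrow> r" for r
    unfolding y_eq
    by (intro tendsto_Pair limit_is_zero(1) isCont_tendsto_compose[OF isCont_g] that)
  then show ?thesis
    using outcome by (elim disjE exE conjE) simp_all
qed

end
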